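(* Let $k$ be a field, $\mathfrak{L}$ a Leibniz algebra over $k$ and $\mathfrak{g}$ a $k$-vector space viewed with the abelian Leibniz algebra structure $\mathfrak{g}_0$. Then $$\mathbb{HL}^2(\mathfrak{L},\mathfrak{g}_0) = \bigsqcup_{(\triangleleft,\triangleright)} HL^2_{(\triangleleft,\triangleright)}(\mathfrak{L},\mathfrak{g}_0),$$ where the coproduct on the right-hand side is in the category of sets (disjoint union), over all possible Leibniz bimodule structures $(\triangleleft,\triangleright)$ over $\mathfrak{L}$ on $\mathfrak{g}$.
   Context: All vector spaces and (bi)linear maps are over an arbitrary field $k$. A Leibniz algebra is a vector space with a bilinear bracket satisfying $[x,[y,z]] = [[x,y],z] - [[x,z],y]$. $\mathfrak{g}_0$ denotes the vector space $\mathfrak{g}$ with the zero (abelian) bracket. $\mathbb{HL}^2(\mathfrak{L},\mathfrak{g}_0)$: consider the set $\mathcal{CS}_0(\mathfrak{L},\mathfrak{g}_0)$ of all triples $(\triangleleft,\triangleright,f)$ of bilinear maps $\triangleleft : \mathfrak{g}\times\mathfrak{L}\to\mathfrak{g}$, $\triangleright : \mathfrak{L}\times\mathfrak{g}\to\mathfrak{g}$, $f : \mathfrak{L}\times\mathfrak{L}\to\mathfrak{g}$ such that $\mathfrak{g}\times\mathfrak{L}$ with the bracket $\{(g,x),(h,y)\} := (x\triangleright h + g\triangleleft y + f(x,y), [x,y])$ is a Leibniz algebra. Set $(\triangleleft,\triangleright,f)\approx_{l,a}(\triangleleft',\triangleright',f')$ iff $\triangleleft=\triangleleft'$, $\triangleright=\triangleright'$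 and there is a linear map $r:\mathfrak{L}\to\mathfrak{g}$ such that $$f(x,y) = f'(x,y) - r([x,y]) + x\triangleright' r(y) + r(x)\triangleleft' y \quad ( * )$$ for all $x,y\in\mathfrak{L}$. Then $\mathbb{HL}^2(\mathfrak{L},\mathfrak{g}_0) := \mathcal{CS}_0(\mathfrak{L},\mathfrak{g}_0)/\approx_{l,a}$. A Leibniz bimodule structure over $\mathfrak{L}$ on $\mathfrak{g}$ is a pair of bilinear maps $\triangleleft : \mathfrak{g}\times\mathfrak{L}\to\mathfrak{g}$, $\triangleright : \mathfrak{L}\times\mathfrak{g}\to\mathfrak{g}$ such that for all $g\in\mathfrak{g}$, $x,y\in\mathfrak{L}$: $g\triangleleft[x,y] = (g\triangleleft x)\triangleleft y - (g\triangleleft y)\triangleleft x$; $[x,y]\triangleright g = x\triangleright(y\triangleright g) + (x\triangleright g)\triangleleft y$; $x\triangleright(y\triangleright g) = -x\triangleright(g\triangleleft y)$. For a fixed Leibniz bimodule structure, $ZL^2_{(\triangleleft,\triangleright)}(\mathfrak{L},\mathfrak{g}_0)$ is the set of 2-cocycles, i.e. bilinear maps $f:\mathfrak{L}\times\mathfrak{L}\to\mathfrak{g}$ with $x\triangleright f(y,z) = f(x,y)\triangleleft z - f(x,z)\triangleleft y + f([x,y],z) - f([x,z],y) - f(x,[y,z])$ for all $x,y,z\in\mathfrak{L}$. Two cocycles $f,f'$ are cohomologous if there is a linear $r:\mathfrak{L}\to\mathfrak{g}$ satisfying $( * )$ (with $\triangleleft'=\triangleleft$, $\triangleright'=\triangleright$),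 and $HL^2_{(\triangleleft,\triangleright)}(\mathfrak{L},\mathfrak{g}_0)$ is the quotient set (the second cohomology group of Loday and Pirashvili). The equality is the canonical identification sending the class of $f$ in the component indexed by $(\triangleleft,\triangleright)$ to the class of $(\triangleleft,\triangleright,f)$. *)

theory Defs
  imports "HOL-Analysis.Product_Vector"
begin

definition bilinear_map ::
    "('k::field \<Rightarrow> 'u::ab_group_add \<Rightarrow> 'u) \<Rightarrow> ('k \<Rightarrow> 'v::ab_group_add \<Rightarrow> 'v) \<Rightarrow>
     ('k \<Rightarrow> 'w::ab_group_add \<Rightarrow> 'w) \<Rightarrow> ('u \<Rightarrow> 'v \<Rightarrow> 'w) \<Rightarrow> bool"
  where "bilinear_map sU sV sW B \<longleftrightarrow>
    (\<forall>u. Vector_Spaces.linear sV sW (B u)) \<and> (\<forall>v. Vector_Spaces.linear sU sW (\<lambda>u. B u v))"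

text \<open>Right Leibniz algebras over an arbitrary field.\<close>

locale leibniz_algebra = vector_space scale
  for scale :: "'k::field \<Rightarrow> 'l::ab_group_add \<Rightarrow> 'l" +
  fixes bracket :: "'l \<Rightarrow> 'l \<Rightarrow> 'l"
  assumes bilinear_bracket: "bilinear_map scale scale scale bracket"
    and leibniz_identity:
      "bracket x (bracket y z) = bracket (bracket x y) z - bracket (bracket x z) y"

text \<open>
  In what follows \<open>sG\<close> and \<open>sL\<close> are the scalar multiplications of the vector spaces
  \<open>\<gg>\<close> and \<open>\<LL>\<close>, \<open>br\<close> is the bracket of \<open>\<LL>\<close>, and \<open>lt g x\<close> and \<open>rt x g\<close> are the actions
  \<open>g \<triangleleft> x\<close> and \<open>x \<triangleright> g\<close>. The zero bracket of \<open>\<gg>\<close> contributes nothing to the bracket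
  on \<open>\<gg> \<times> \<LL>\<close> and therefore does not appear.
\<close>

definition extension_bracket ::
    "('l \<Rightarrow> 'l \<Rightarrow> 'l) \<Rightarrow> ('g \<Rightarrow> 'l \<Rightarrow> 'g) \<Rightarrow> ('l \<Rightarrow> 'g \<Rightarrow> 'g) \<Rightarrow> ('l \<Rightarrow> 'l \<Rightarrow> 'g::plus) \<Rightarrow>
     'g \<times> 'l \<Rightarrow> 'g \<times> 'l \<Rightarrow> 'g \<times> 'l"
  where "extension_bracket br lt rt f =
    (\<lambda>(g, x) (h, y). (rt x h + lt g y + f x y, br x y))"

definition CS0 ::
    "('k::field \<Rightarrow> 'l::ab_group_add \<Rightarrow> 'l) \<Rightarrow> ('l \<Rightarrow> 'l \<Rightarrow> 'l) \<Rightarrow>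
     ('k \<Rightarrow> 'g::ab_group_add \<Rightarrow> 'g) \<Rightarrow>
     (('g \<Rightarrow> 'l \<Rightarrow> 'g) \<times> ('l \<Rightarrow> 'g \<Rightarrow> 'g) \<times> ('l \<Rightarrow> 'l \<Rightarrow> 'g)) set"
  where "CS0 sL br sG = {(lt, rt, f).
    bilinear_map sG sL sG lt \<and> bilinear_map sL sG sG rt \<and> bilinear_map sL sL sG f \<and>
    leibniz_algebra (module_prod.scale sG sL) (extension_bracket br lt rt f)}"

text \<open>
  Equality of \<open>f\<close> and \<open>f'\<close> up to the coboundary of some linear map \<open>r : \<LL> \<rightarrow> \<gg>\<close>.
\<close>

definition differ_by_coboundary ::
    "('k::field \<Rightarrow> 'l::ab_group_add \<Rightarrow> 'l) \<Rightarrow> ('l \<Rightarrow> 'l \<Rightarrow> 'l) \<Rightarrow>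
     ('k \<Rightarrow> 'g::ab_group_add \<Rightarrow> 'g) \<Rightarrow> ('g \<Rightarrow> 'l \<Rightarrow> 'g) \<Rightarrow> ('l \<Rightarrow> 'g \<Rightarrow> 'g) \<Rightarrow>
     ('l \<Rightarrow> 'l \<Rightarrow> 'g) \<Rightarrow> ('l \<Rightarrow> 'l \<Rightarrow> 'g) \<Rightarrow> bool"
  where "differ_by_coboundary sL br sG lt rt f f' \<longleftrightarrow>
    (\<exists>r. Vector_Spaces.linear sL sG r \<and>
      (\<forall>x y. f x y = f' x y - r (br x y) + rt x (r y) + lt (r x) y))"

definition approx_la ::
    "('k::field \<Rightarrow> 'l::ab_group_add \<Rightarrow> 'l) \<Rightarrow> ('l \<Rightarrow> 'l \<Rightarrow> 'l) \<Rightarrow>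
     ('k \<Rightarrow> 'g::ab_group_add \<Rightarrow> 'g) \<Rightarrow>
     (('g \<Rightarrow> 'l \<Rightarrow> 'g) \<times> ('l \<Rightarrow> 'g \<Rightarrow> 'g) \<times> ('l \<Rightarrow> 'l \<Rightarrow> 'g)) rel"
  where "approx_la sL br sG = {((lt, rt, f), (lt', rt', f')).
    (lt, rt, f) \<in> CS0 sL br sG \<and> (lt', rt', f') \<in> CS0 sL br sG \<and>
    lt = lt' \<and> rt = rt' \<and> differ_by_coboundary sL br sG lt' rt' f f'}"

definition total_HL2 ::
    "('k::field \<Rightarrow> 'l::ab_group_add \<Rightarrow> 'l) \<Rightarrow> ('l \<Rightarrow> 'l \<Rightarrow> 'l) \<Rightarrow>
     ('k \<Rightarrow> 'g::ab_group_add \<Rightarrow> 'g) \<Rightarrow>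
     (('g \<Rightarrow> 'l \<Rightarrow> 'g) \<times> ('l \<Rightarrow> 'g \<Rightarrow> 'g) \<times> ('l \<Rightarrow> 'l \<Rightarrow> 'g)) set set"
  where "total_HL2 sL br sG = CS0 sL br sG // approx_la sL br sG"

definition leibniz_bimodules ::
    "('k::field \<Rightarrow> 'l::ab_group_add \<Rightarrow> 'l) \<Rightarrow> ('l \<Rightarrow> 'l \<Rightarrow> 'l) \<Rightarrow>
     ('k \<Rightarrow> 'g::ab_group_add \<Rightarrow> 'g) \<Rightarrow> (('g \<Rightarrow> 'l \<Rightarrow> 'g) \<times> ('l \<Rightarrow> 'g \<Rightarrow> 'g)) set"
  where "leibniz_bimodules sL br sG = {(lt, rt).
    bilinear_map sG sL sG lt \<and> bilinear_map sL sG sG rt \<and>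
    (\<forall>g x y. lt g (br x y) = lt (lt g x) y - lt (lt g y) x) \<and>
    (\<forall>g x y. rt (br x y) g = rt x (rt y g) + lt (rt x g) y) \<and>
    (\<forall>g x y. rt x (rt y g) = - rt x (lt g y))}"

definition ZL2 ::
    "('k::field \<Rightarrow> 'l::ab_group_add \<Rightarrow> 'l) \<Rightarrow> ('l \<Rightarrow> 'l \<Rightarrow> 'l) \<Rightarrow>
     ('k \<Rightarrow> 'g::ab_group_add \<Rightarrow> 'g) \<Rightarrow> ('g \<Rightarrow> 'l \<Rightarrow> 'g) \<Rightarrow> ('l \<Rightarrow> 'g \<Rightarrow> 'g) \<Rightarrow>
     ('l \<Rightarrow> 'l \<Rightarrow> 'g) set"
  where "ZL2 sL br sG lt rt = {f. bilinear_map sL sL sG f \<and>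
    (\<forall>x y z. rt x (f y z) =
      lt (f x y) z - lt (f x z) y + f (br x y) z - f (br x z) y - f x (br y z))}"

definition cohomologous ::
    "('k::field \<Rightarrow> 'l::ab_group_add \<Rightarrow> 'l) \<Rightarrow> ('l \<Rightarrow> 'l \<Rightarrow> 'l) \<Rightarrow>
     ('k \<Rightarrow> 'g::ab_group_add \<Rightarrow> 'g) \<Rightarrow> ('g \<Rightarrow> 'l \<Rightarrow> 'g) \<Rightarrow> ('l \<Rightarrow> 'g \<Rightarrow> 'g) \<Rightarrow>
     ('l \<Rightarrow> 'l \<Rightarrow> 'g) rel"
  where "cohomologous sL br sG lt rt = {(f, f').
    f \<in> ZL2 sL br sG lt rt \<and> f' \<in> ZL2 sL br sG lt rt \<and>
    differ_by_coboundary sL br sG lt rt f f'}"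

definition HL2 ::
    "('k::field \<Rightarrow> 'l::ab_group_add \<Rightarrow> 'l) \<Rightarrow> ('l \<Rightarrow> 'l \<Rightarrow> 'l) \<Rightarrow>
     ('k \<Rightarrow> 'g::ab_group_add \<Rightarrow> 'g) \<Rightarrow> ('g \<Rightarrow> 'l \<Rightarrow> 'g) \<Rightarrow> ('l \<Rightarrow> 'g \<Rightarrow> 'g) \<Rightarrow>
     ('l \<Rightarrow> 'l \<Rightarrow> 'g) set set"
  where "HL2 sL br sG lt rt = ZL2 sL br sG lt rt // cohomologous sL br sG lt rt"

end

theory Submission
  imports Defs
begin

text \<open>
  In the Leibniz identity of the bracket on \<open>\<gg> \<times> \<LL>\<close>, each side is a sum of
  one linear term for each of the three \<open>\<gg>\<close>-components and a term free of them. Setting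
  all or all but one of these components to zero therefore splits the identity into the cocycle
  identity and the three bimodule axioms, so an element of \<open>CS0\<close> is a bimodule structure
  together with a cocycle for it. Since equivalent triples share their bimodule
  structure, the class of \<open>(\<triangleleft>, \<triangleright>, f)\<close> is the cohomology class of \<open>f\<close>
  tagged with \<open>(\<triangleleft>, \<triangleright>)\<close>.
\<close>

section \<open>Linear and bilinear maps, and scalars on a product space\<close>

lemma linear_iff_vector_space:
  assumes "vector_space s1" "vector_space s2"
  shows "Vector_Spaces.linear s1 s2 r \<longleftrightarrow>
    (\<forall>x y. r (x + y) = r x + r y) \<and> (\<forall>c x. r (s1 c x) = s2 c (r x))"
  using assms by (auto simp: Vector_Spaces.linear_iff)

lemma bilinear_map_iff:
  assumes "vector_space sU" "vector_space sV" "vector_space sW"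
  shows "bilinear_map sU sV sW B \<longleftrightarrow>
    (\<forall>u v v'. B u (v + v') = B u v + B u v') \<and> (\<forall>u c v. B u (sV c v) = sW c (B u v)) \<and>
    (\<forall>u u' v. B (u + u') v = B u v + B u' v) \<and> (\<forall>c u v. B (sU c u) v = sW c (B u v))"
  unfolding bilinear_map_def linear_iff_vector_space[OF assms(1,3)]
    linear_iff_vector_space[OF assms(2,3)] by blast

lemma bilinear_map_simps:
  assumes "bilinear_map sU sV sW B"
  shows "B u (v + v') = B u v + B u v'" "B (u + u') v = B u v + B u' v"
    "B u (v - v') = B u v - B u v'" "B (u - u') v = B u v - B u' v"
    "B u (- v) = - B u v" "B (- u) v = - B u v"
    "B u 0 = 0" "B 0 v = 0"
    "B u (sV c v) = sW c (B u v)" "B (sU c u) v = sW c (B u v)"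
proof -
  interpret r: Vector_Spaces.linear sV sW "B u"
    using assms by (simp add: bilinear_map_def)
  interpret l: Vector_Spaces.linear sU sW "\<lambda>u. B u v"
    using assms by (simp add: bilinear_map_def)
  show "B u (v + v') = B u v + B u v'" "B (u + u') v = B u v + B u' v"
    "B u (v - v') = B u v - B u v'" "B (u - u') v = B u v - B u' v"
    "B u (- v) = - B u v" "B (- u) v = - B u v"
    "B u 0 = 0" "B 0 v = 0"
    "B u (sV c v) = sW c (B u v)" "B (sU c u) v = sW c (B u v)"
    by (simp_all add: r.add l.add r.diff l.diff r.neg l.neg r.scale l.scale)
qed

lemma vector_space_module_prod:
  assumes "vector_space s1" "vector_space s2"
  shows "vector_space (module_prod.scale s1 s2)"
proof -
  interpret vector_space_prod s1 s2
    using assms by (simp add: vector_space_prod_def vector_space_pair_def)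
  show ?thesis by (rule p.vector_space_axioms)
qed

lemma module_prod_scale_Pair:
  assumes "vector_space s1" "vector_space s2"
  shows "module_prod.scale s1 s2 c (a, b) = (s1 c a, s2 c b)"
proof -
  interpret vector_space_prod s1 s2
    using assms by (simp add: vector_space_prod_def vector_space_pair_def)
  show ?thesis by (simp add: scale_def)
qed

section \<open>Brackets on the product as bimodule structures with a cocycle\<close>

lemma bilinear_map_extension_bracket:
  assumes vs: "vector_space sL" "vector_space sG"
    and "bilinear_map sL sL sL br" "bilinear_map sG sL sG lt"
    and "bilinear_map sL sG sG rt" "bilinear_map sL sL sG f"
  shows "bilinear_map (module_prod.scale sG sL) (module_prod.scale sG sL)
    (module_prod.scale sG sL) (extension_bracket br lt rt f)"
proof -
  note simps = assms(3-6)[THEN bilinear_map_simps(1)] assms(3-6)[THEN bilinear_map_simps(2)]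
    assms(3-6)[THEN bilinear_map_simps(9)] assms(3-6)[THEN bilinear_map_simps(10)]
  have scale: "sG c (a + b) = sG c a + sG c b" for c a b
    using vs(2) by (simp add: vector_space.vector_space_assms)
  note vp = vector_space_module_prod[OF vs(2,1)]
  show ?thesis
    unfolding bilinear_map_iff[OF vp vp vp]
    by (auto simp: extension_bracket_def module_prod_scale_Pair[OF vs(2,1)] simps scale algebra_simps)
qed

lemma extension_bracket_leibniz_iff:
  fixes br :: "'l::ab_group_add \<Rightarrow> 'l \<Rightarrow> 'l" and f :: "'l \<Rightarrow> 'l \<Rightarrow> 'g::ab_group_add"
  assumes "bilinear_map sG sL sG lt" "bilinear_map sL sG sG rt" "bilinear_map sL sL sG f"
    and br: "bilinear_map sL sL sL br"
    and leibniz: "\<And>x y z. br x (br y z) = br (br x y) z - br (br x z) y"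
  defines "E \<equiv> extension_bracket br lt rt f"
  shows "(\<forall>X Y Z. E X (E Y Z) = E (E X Y) Z - E (E X Z) Y) \<longleftrightarrow>
    (\<forall>g x y. lt g (br x y) = lt (lt g x) y - lt (lt g y) x) \<and>
    (\<forall>g x y. rt (br x y) g = rt x (rt y g) + lt (rt x g) y) \<and>
    (\<forall>g x y. rt x (rt y g) = - rt x (lt g y)) \<and>
    (\<forall>x y z. rt x (f y z) =
      lt (f x y) z - lt (f x z) y + f (br x y) z - f (br x z) y - f x (br y z))"
    (is "?L \<longleftrightarrow> ?R")
proof -
  note simps = assms(1-4)[THEN bilinear_map_simps(1)] assms(1-4)[THEN bilinear_map_simps(2)]
    assms(1-4)[THEN bilinear_map_simps(7)] assms(1-4)[THEN bilinear_map_simps(8)]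
  show ?thesis
  proof
    assume ?L
    \<comment> \<open>The first component of the identity at the elements \<open>(g, x)\<close>,
      \<open>(h, y)\<close> and \<open>(k, z)\<close>.\<close>
    then have *: "rt x (rt y k + lt h z + f y z) + lt g (br y z) + f x (br y z) =
        (rt (br x y) k + lt (rt x h + lt g y + f x y) z + f (br x y) z) -
        (rt (br x z) h + lt (rt x k + lt g z + f x z) y + f (br x z) y)" for g x h y k z
      unfolding E_def
      by (drule_tac spec[of _ "(g, x)"], drule_tac spec[of _ "(h, y)"],
          drule_tac spec[of _ "(k, z)"]) (simp add: extension_bracket_def)
    \<comment> \<open>In \<open>*[of ...]\<close> the variables come in their order of occurrence:
      \<open>x\<close>, \<open>y\<close>, \<open>k\<close>, \<open>h\<close>, \<open>z\<close>,
      \<open>g\<close>. At most one of \<open>g\<close>, \<open>h\<close>, \<open>k\<close> is kept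
      each time. When one is kept, the \<open>\<LL>\<close>-argument paired with it is set to zero,
      which kills every term containing \<open>f\<close>.\<close>
    have f: "rt x (f y z) =
        lt (f x y) z - lt (f x z) y + f (br x y) z - f (br x z) y - f x (br y z)" for x y z
      using *[of x y 0 0 z 0] by (simp add: simps algebra_simps)
    have lt: "lt g (br y z) = lt (lt g y) z - lt (lt g z) y" for g y z
      using *[of 0 y 0 0 z g] by (simp add: simps)
    have rt: "rt (br x y) k = rt x (rt y k) + lt (rt x k) y" for x y k
      using *[of x y k 0 0 0] by (simp add: simps algebra_simps)
    \<comment> \<open>Keeping \<open>h\<close> gives no axiom directly. Its right-hand side is the
      negative of the one obtained from \<open>rt\<close> for \<open>rt x (rt z h)\<close>, and
      comparing the two yields the third axiom.\<close>
    have "rt x (lt h z) = lt (rt x h) z - rt (br x z) h" for x h z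
      using *[of x 0 0 h z 0] by (simp add: simps algebra_simps)
    then have "rt x (rt z h) = - rt x (lt h z)" for x h z
      by (simp add: rt)
    with f lt rt show ?R by blast
  next
    assume R: ?R
    have lt: "lt g (br y z) = lt (lt g y) z - lt (lt g z) y" for g y z
      using R by blast
    have rt: "rt x (rt y k) = rt (br x y) k - lt (rt x k) y" for x y k
      using R by simp
    have "rt x (lt h z) = - rt x (rt z h)" for x h z
      using R by simp
    \<comment> \<open>The third axiom is put in the form that expands \<open>rt x\<close> applied to
      an action, matching \<open>rt\<close>. With \<open>lt\<close> and \<open>f\<close> these rules
      bring both sides of the identity on pairs to the same sum in the first component;
      \<open>leibniz\<close> settles the second.\<close>
    then have rt_lt: "rt x (lt h z) = lt (rt x h) z - rt (br x z) h" for x h z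
      by (simp add: rt)
    have f: "rt x (f y z) =
        lt (f x y) z - lt (f x z) y + f (br x y) z - f (br x z) y - f x (br y z)" for x y z
      using R by blast
    have "E (g, x) (E (h, y) (k, z)) =
        E (E (g, x) (h, y)) (k, z) - E (E (g, x) (k, z)) (h, y)" for g x h y k z
      by (simp add: E_def extension_bracket_def simps lt rt rt_lt f leibniz[of x y z])
    then show ?L by auto
  qed
qed

lemma CS0_iff:
  assumes L: "leibniz_algebra sL br" and G: "vector_space sG"
  shows "(lt, rt, f) \<in> CS0 sL br sG \<longleftrightarrow>
    (lt, rt) \<in> leibniz_bimodules sL br sG \<and> f \<in> ZL2 sL br sG lt rt"
proof -
  interpret L: leibniz_algebra sL br by fact
  note vs = L.vector_space_axioms G
  show ?thesis
  \<comment> \<open>Both sides demand bilinearity of the three maps. Once it is granted, the product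
    is a vector space and the bracket on it is bilinear, so being a Leibniz algebra reduces to the
    identity treated above.\<close>
  proof (cases "bilinear_map sG sL sG lt \<and> bilinear_map sL sG sG rt \<and> bilinear_map sL sL sG f")
    case True
    then have bil: "bilinear_map sG sL sG lt" "bilinear_map sL sG sG rt" "bilinear_map sL sL sG f"
      by auto
    let ?E = "extension_bracket br lt rt f"
    have "leibniz_algebra (module_prod.scale sG sL) ?E \<longleftrightarrow>
        (\<forall>X Y Z. ?E X (?E Y Z) = ?E (?E X Y) Z - ?E (?E X Z) Y)"
      using bilinear_map_extension_bracket[OF vs L.bilinear_bracket bil]
        vector_space_module_prod[OF vs(2,1)]
      by (simp add: leibniz_algebra_def leibniz_algebra_axioms_def)
    also note extension_bracket_leibniz_iff[OF bil L.bilinear_bracket L.leibniz_identity]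
    finally show ?thesis
      using bil by (simp only: CS0_def leibniz_bimodules_def ZL2_def mem_Collect_eq prod.case) blast
  next
    case False
    then show ?thesis by (auto simp: CS0_def leibniz_bimodules_def ZL2_def)
  qed
qed

section \<open>The two equivalence relations and their classes\<close>

lemma equiv_cohomologous:
  assumes L: "vector_space sL" and G: "vector_space sG"
    and lt: "bilinear_map sG sL sG lt" and rt: "bilinear_map sL sG sG rt"
  shows "equiv (ZL2 sL br sG lt rt) (cohomologous sL br sG lt rt)"
proof -
  note linear = linear_iff_vector_space[OF L G]
  interpret G: vector_space sG by fact
  note simps = lt[THEN bilinear_map_simps(1)] rt[THEN bilinear_map_simps(1)]
    lt[THEN bilinear_map_simps(2)] rt[THEN bilinear_map_simps(2)]
    lt[THEN bilinear_map_simps(5)] rt[THEN bilinear_map_simps(5)]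
    lt[THEN bilinear_map_simps(6)] rt[THEN bilinear_map_simps(6)]
    lt[THEN bilinear_map_simps(7)] rt[THEN bilinear_map_simps(7)]
    lt[THEN bilinear_map_simps(8)] rt[THEN bilinear_map_simps(8)]
  \<comment> \<open>The correction term in \<open>differ_by_coboundary\<close> is additive in
    \<open>r\<close>. Hence \<open>0\<close>, \<open>- r\<close> and \<open>r + r'\<close> witness
    reflexivity, symmetry and transitivity.\<close>
  let ?D = "differ_by_coboundary sL br sG lt rt"
  have refl: "?D f f" for f
    unfolding differ_by_coboundary_def linear by (rule exI[of _ "\<lambda>_. 0"]) (simp add: simps)
  have sym: "?D f' f" if "?D f f'" for f f'
  proof -
    from that obtain r where "Vector_Spaces.linear sL sG r"
      "\<And>x y. f x y = f' x y - r (br x y) + rt x (r y) + lt (r x) y"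
      unfolding differ_by_coboundary_def by blast
    then show ?thesis
      unfolding differ_by_coboundary_def linear
      by (intro exI[of _ "\<lambda>x. - r x"]) (simp add: simps)
  qed
  have trans: "?D f f''" if "?D f f'" "?D f' f''" for f f' f''
  proof -
    from that obtain r r' where "Vector_Spaces.linear sL sG r" "Vector_Spaces.linear sL sG r'"
      "\<And>x y. f x y = f' x y - r (br x y) + rt x (r y) + lt (r x) y"
      "\<And>x y. f' x y = f'' x y - r' (br x y) + rt x (r' y) + lt (r' x) y"
      unfolding differ_by_coboundary_def by blast
    then show ?thesis
      unfolding differ_by_coboundary_def linear
      by (intro exI[of _ "\<lambda>x. r x + r' x"]) (simp add: simps G.scale_right_distrib algebra_simps)
  qed
  show ?thesis
    by (intro equivI refl_onI symI transI) (auto simp: cohomologous_def intro: refl sym trans)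
qed

lemma approx_la_iff:
  assumes "leibniz_algebra sL br" "vector_space sG"
  shows "((lt, rt, f), (lt', rt', f')) \<in> approx_la sL br sG \<longleftrightarrow>
    (lt, rt) \<in> leibniz_bimodules sL br sG \<and> lt' = lt \<and> rt' = rt \<and>
    (f, f') \<in> cohomologous sL br sG lt rt"
  by (auto simp: approx_la_def cohomologous_def CS0_iff[OF assms])

text \<open>Equivalence never changes the bimodule structure, so a class of triples is a cohomology
  class with a constant tag. This shape dictates the definition of the bijection below.\<close>

lemma approx_la_class:
  assumes "leibniz_algebra sL br" "vector_space sG" "(lt, rt) \<in> leibniz_bimodules sL br sG"
  shows "approx_la sL br sG `` {(lt, rt, f)} =
    (\<lambda>h. (lt, rt, h)) ` (cohomologous sL br sG lt rt `` {f})"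
  using assms(3) by (auto simp: approx_la_iff[OF assms(1,2)])

theorem corollary2p7:
  fixes sL :: "'k::field \<Rightarrow> 'l::ab_group_add \<Rightarrow> 'l"
    and br :: "'l \<Rightarrow> 'l \<Rightarrow> 'l"
    and sG :: "'k \<Rightarrow> 'g::ab_group_add \<Rightarrow> 'g"
  assumes "leibniz_algebra sL br"
    and "vector_space sG"
  shows "equiv (CS0 sL br sG) (approx_la sL br sG) \<and>
    (\<forall>(lt, rt) \<in> leibniz_bimodules sL br sG.
       equiv (ZL2 sL br sG lt rt) (cohomologous sL br sG lt rt)) \<and>
    (\<exists>\<Phi>. bij_betw \<Phi>
           (SIGMA (lt, rt) : leibniz_bimodules sL br sG. HL2 sL br sG lt rt)
           (total_HL2 sL br sG) \<and>
         (\<forall>(lt, rt) \<in> leibniz_bimodules sL br sG. \<forall>f \<in> ZL2 sL br sG lt rt.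
           \<Phi> ((lt, rt), cohomologous sL br sG lt rt `` {f}) =
           approx_la sL br sG `` {(lt, rt, f)}))"
proof (intro conjI)
  interpret L: leibniz_algebra sL br by fact
  let ?B = "leibniz_bimodules sL br sG"
  have coh: "equiv (ZL2 sL br sG lt rt) (cohomologous sL br sG lt rt)" if "(lt, rt) \<in> ?B" for lt rt
    using that equiv_cohomologous[OF L.vector_space_axioms assms(2)]
    by (auto simp: leibniz_bimodules_def)
  then show "\<forall>(lt, rt) \<in> ?B. equiv (ZL2 sL br sG lt rt) (cohomologous sL br sG lt rt)"
    by blast
  show "equiv (CS0 sL br sG) (approx_la sL br sG)"
  \<comment> \<open>By \<open>approx_la_iff\<close> related triples lie over one bimodule structure,
    so each property is inherited from \<open>coh\<close> for that structure.\<close>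
  proof (intro equivI)
    show "approx_la sL br sG \<subseteq> CS0 sL br sG \<times> CS0 sL br sG"
      by (auto simp: approx_la_def)
    show "refl_on (CS0 sL br sG) (approx_la sL br sG)"
      using coh by (auto intro!: refl_onI
          simp: approx_la_iff[OF assms] CS0_iff[OF assms] equiv_def refl_on_def)
    show "sym (approx_la sL br sG)"
    proof (rule symI; clarsimp simp: approx_la_iff[OF assms])
      fix lt rt f f' assume "(lt, rt) \<in> ?B" "(f, f') \<in> cohomologous sL br sG lt rt"
      then show "(f', f) \<in> cohomologous sL br sG lt rt"
        using coh[of lt rt] by (auto simp: equiv_def dest: symD)
    qed
    show "trans (approx_la sL br sG)"
    proof (rule transI; clarsimp simp: approx_la_iff[OF assms])
      fix lt rt f f' f''
      assume "(lt, rt) \<in> ?B" "(f, f') \<in> cohomologous sL br sG lt rt"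
        "(f', f'') \<in> cohomologous sL br sG lt rt"
      then show "(f, f'') \<in> cohomologous sL br sG lt rt"
        using coh[of lt rt] by (auto simp: equiv_def dest: transD)
    qed
  qed
  \<comment> \<open>Defining the map on whole classes, as an image, avoids a choice of
    representatives and any check of well-definedness.\<close>
  define \<Phi> where "\<Phi> = (\<lambda>((lt, rt), C). (\<lambda>h :: 'l \<Rightarrow> 'l \<Rightarrow> 'g.
    (lt :: 'g \<Rightarrow> 'l \<Rightarrow> 'g, rt :: 'l \<Rightarrow> 'g \<Rightarrow> 'g, h)) ` C)"
  have \<Phi>_class: "\<Phi> ((lt, rt), cohomologous sL br sG lt rt `` {f}) =
      approx_la sL br sG `` {(lt, rt, f)}" if "(lt, rt) \<in> ?B" for lt rt f
    using approx_la_class[OF assms that] by (simp add: \<Phi>_def)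
  have "inj_on \<Phi> (SIGMA (lt, rt) : ?B. HL2 sL br sG lt rt)"
  proof (rule inj_onI; clarsimp)
    fix lt rt C lt' rt' C'
    assume B: "(lt, rt) \<in> ?B" and C: "C \<in> HL2 sL br sG lt rt"
      and eq: "\<Phi> ((lt, rt), C) = \<Phi> ((lt', rt'), C')"
    \<comment> \<open>The tag can be recovered only from an element of the image: the empty set
      would have the same image under every tag. Once the tags agree, injectivity of tagging gives
      \<open>C = C'\<close>.\<close>
    have "C \<noteq> {}"
      using C in_quotient_imp_non_empty[OF coh[OF B]] by (simp add: HL2_def)
    then obtain h where "h \<in> C" by blast
    then have "(lt, rt, h) \<in> \<Phi> ((lt', rt'), C')"
      unfolding eq[symmetric] by (simp add: \<Phi>_def)
    then have "lt' = lt" "rt' = rt" by (auto simp: \<Phi>_def)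
    moreover from this have "C = C'"
      using eq by (simp add: \<Phi>_def inj_image_eq_iff inj_def)
    ultimately show "lt = lt' \<and> rt = rt' \<and> C = C'" by simp
  qed
  moreover have "\<Phi> ` (SIGMA (lt, rt) : ?B. HL2 sL br sG lt rt) = total_HL2 sL br sG"
  proof (intro equalityI subsetI)
    fix D assume "D \<in> \<Phi> ` (SIGMA (lt, rt) : ?B. HL2 sL br sG lt rt)"
    then obtain lt rt f where "(lt, rt) \<in> ?B" "f \<in> ZL2 sL br sG lt rt"
      "D = \<Phi> ((lt, rt), cohomologous sL br sG lt rt `` {f})"
      by (auto simp: HL2_def elim!: quotientE)
    then show "D \<in> total_HL2 sL br sG"
      by (auto simp: \<Phi>_class total_HL2_def CS0_iff[OF assms] intro!: quotientI)
  next
    fix D assume "D \<in> total_HL2 sL br sG"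
    \<comment> \<open>A representative triple splits by \<open>CS0_iff\<close> into the index of a
      component and a cocycle there, whose class is the required preimage.\<close>
    then obtain lt rt f where B: "(lt, rt) \<in> ?B" and "f \<in> ZL2 sL br sG lt rt"
      and D: "D = approx_la sL br sG `` {(lt, rt, f)}"
      by (auto simp: total_HL2_def CS0_iff[OF assms] elim!: quotientE)
    then have "((lt, rt), cohomologous sL br sG lt rt `` {f}) \<in>
        (SIGMA (lt, rt) : ?B. HL2 sL br sG lt rt)"
      by (auto simp: HL2_def intro: quotientI)
    then show "D \<in> \<Phi> ` (SIGMA (lt, rt) : ?B. HL2 sL br sG lt rt)"
      unfolding D \<Phi>_class[OF B, symmetric] by (rule imageI)
  qed
  ultimately show "\<exists>\<Phi>. bij_betw \<Phi>
           (SIGMA (lt, rt) : leibniz_bimodules sL br sG. HL2 sL br sG lt rt)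
           (total_HL2 sL br sG) \<and>
         (\<forall>(lt, rt) \<in> leibniz_bimodules sL br sG. \<forall>f \<in> ZL2 sL br sG lt rt.
           \<Phi> ((lt, rt), cohomologous sL br sG lt rt `` {f}) =
           approx_la sL br sG `` {(lt, rt, f)})"
    using \<Phi>_class by (auto simp: bij_betw_def intro!: exI[of _ \<Phi>])
qed

end
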